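(* Let $\mathrm{pps}>0$ be the packet generation rate (packets per second) and $T>0$ the horizon length (seconds), so that $N_{\mathrm{pkt}}=\mathrm{pps}\,T$ packets are generated. Let $L_{\mathrm{bits}}>0$ be the payload length (bits), $R>0$ the data rate (bits per second), $P_t>0$ the transmit power, $H\in\mathbb{N}$, $H\ge 1$, the maximum number of transmission attempts per generated packet, and $\mathrm{PRR}\in(0,1]$ the success probability of each attempt. Then the expected total RF transmit energy over the horizon is $$E_{\mathrm{total}}=N_{\mathrm{pkt}}\,P_t\,\frac{L_{\mathrm{bits}}}{R}\;\frac{1-(1-\mathrm{PRR})^{H}}{\mathrm{PRR}}.$$
   Context: Transmission model (truncated HARQ): for each generated packet, transmission attempts are made one after another until the first correct reception or until $H$ attempts have been made, whichever comes first. Attempts are independent and identically distributed, each being successful with probability $\mathrm{PRR}$ (packet reception ratio). Each attempt lasts $L_{\mathrm{bits}}/R$ seconds and is carried out at power $P_t$, so it consumes RF energy $P_t L_{\mathrm{bits}}/R$. The total RF transmit energy over the horizon is the sum, over all $N_{\mathrm{pkt}}$ (taken to be a nonnegative integer) generated packets, of the energies of all attempts actually made; $E_{\mathrm{total}}$ denotes its expectation. *)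

theory Defs
  imports "HOL-Probability.Probability"
begin

(* success i j \<omega> is the outcome of the j-th potential attempt (counted from 0) for packet i.
   The outcomes are given for all j < H; whether attempt j is really made is decided by the
   stopping rule: it is made iff the cap H is not yet reached and no earlier attempt for
   the same packet succeeded. *)
definition attempts_made ::
  "nat \<Rightarrow> (nat \<Rightarrow> nat \<Rightarrow> 'w \<Rightarrow> bool) \<Rightarrow> nat \<Rightarrow> 'w \<Rightarrow> nat set" where
  "attempts_made H success i \<omega> = {j. j < H \<and> (\<forall>k<j. \<not> success i k \<omega>)}"

definition attempt_energy :: "real \<Rightarrow> real \<Rightarrow> real \<Rightarrow> real" where
  "attempt_energy P_t L_bits R = P_t * (L_bits / R)"

definition total_energy ::
  "nat \<Rightarrow> nat \<Rightarrow> real \<Rightarrow> real \<Rightarrow> real \<Rightarrow> (nat \<Rightarrow> nat \<Rightarrow> 'w \<Rightarrow> bool) \<Rightarrow> 'w \<Rightarrow> real" where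
  "total_energy N_pkt H P_t L_bits R success \<omega> =
     (\<Sum>i<N_pkt. \<Sum>j\<in>attempts_made H success i \<omega>. attempt_energy P_t L_bits R)"

definition E_total ::
  "'w measure \<Rightarrow> nat \<Rightarrow> nat \<Rightarrow> real \<Rightarrow> real \<Rightarrow> real \<Rightarrow> (nat \<Rightarrow> nat \<Rightarrow> 'w \<Rightarrow> bool) \<Rightarrow> real" where
  "E_total M N_pkt H P_t L_bits R success =
     prob_space.expectation M (total_energy N_pkt H P_t L_bits R success)"

end

theory Submission
  imports Defs
begin

text \<open>
  Attempt \<open>j\<close> of a packet is made iff the first \<open>j\<close> potential attempts all fail, which has
  probability \<open>(1 - PRR) ^ j\<close>. By linearity of expectation, each packet costs the energy of one
  attempt times a finite geometric sum.
\<close>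

text \<open>The inner sum of the energy runs over a random set of attempts. Moving the stopping rule
  into a 0/1 factor leaves fixed index ranges, over which expectation is linear.\<close>

lemma total_energy_eq_indicators:
  "total_energy N H P_t L_bits R success \<omega> =
     (\<Sum>i<N. \<Sum>j<H. attempt_energy P_t L_bits R * of_bool (\<forall>k<j. \<not> success i k \<omega>))"
proof -
  have "(\<Sum>j\<in>attempts_made H success i \<omega>. attempt_energy P_t L_bits R) =
        (\<Sum>j<H. attempt_energy P_t L_bits R * of_bool (\<forall>k<j. \<not> success i k \<omega>))" for i
  proof -
    have "(\<Sum>j<H. attempt_energy P_t L_bits R * of_bool (\<forall>k<j. \<not> success i k \<omega>)) =
          (\<Sum>j<H. if \<forall>k<j. \<not> success i k \<omega> then attempt_energy P_t L_bits R else 0)"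
      by (intro sum.cong) auto
    also have "\<dots> = (\<Sum>j\<in>{j \<in> {..<H}. \<forall>k<j. \<not> success i k \<omega>}. attempt_energy P_t L_bits R)"
      by (rule sum.inter_filter [symmetric]) simp
    finally show ?thesis
      by (simp only: attempts_made_def lessThan_iff)
  qed
  then show ?thesis
    by (simp only: total_energy_def)
qed

context prob_space
begin

text \<open>Independence turns the probability of a joint failure into a product of equal factors.
  The index type is arbitrary so that the indices can be packet-attempt pairs.\<close>

lemma prob_all_fail:
  fixes success :: "'i \<Rightarrow> 'a \<Rightarrow> bool"
  assumes "finite S"
    and indep: "indep_vars (\<lambda>_. count_space UNIV) success S"
    and prob: "\<And>s. s \<in> S \<Longrightarrow> prob {\<omega> \<in> space M. success s \<omega>} = p"
  shows "{\<omega> \<in> space M. \<forall>s\<in>S. \<not> success s \<omega>} \<in> events" (is "?A \<in> _")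
    and "prob {\<omega> \<in> space M. \<forall>s\<in>S. \<not> success s \<omega>} = (1 - p) ^ card S"
proof -
  have meas: "success s \<in> measurable M (count_space UNIV)" if "s \<in> S" for s
    using indep that by (auto simp: indep_vars_def)
  have "{\<omega> \<in> space M. \<not> success s \<omega>} \<in> events" if "s \<in> S" for s
    using meas [OF that] by measurable
  then show "?A \<in> events"
    using \<open>finite S\<close> by (intro sets.sets_Collect_finite_All) auto
  show "prob ?A = (1 - p) ^ card S"
  \<comment> \<open>The product rule \<open>indep_varsD\<close> requires a nonempty index set. The
    empty case gives probability 1: a first attempt is always made.\<close>
  proof (cases "S = {}")
    case True
    then show ?thesis
      by (simp add: prob_space)
  next
    case False
    have "?A = (\<Inter>s\<in>S. success s -` {False} \<inter> space M)"
      using False by auto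
    also have "prob \<dots> = (\<Prod>s\<in>S. prob (success s -` {False} \<inter> space M))"
      using False \<open>finite S\<close> by (intro indep_varsD [OF indep]) auto
    also have "\<dots> = (\<Prod>s\<in>S. 1 - p)"
    proof (rule prod.cong)
      fix s assume s: "s \<in> S"
      have "success s -` {False} \<inter> space M = space M - {\<omega> \<in> space M. success s \<omega>}"
        by auto
      moreover have "{\<omega> \<in> space M. success s \<omega>} \<in> events"
        using meas [OF s] by measurable
      ultimately show "prob (success s -` {False} \<inter> space M) = 1 - p"
        by (simp add: prob_compl prob [OF s])
    qed simp
    finally show ?thesis
      by simp
  qed
qed

text \<open>Keeping the sum unevaluated avoids division by \<open>p\<close>, so the identity also
  covers \<open>p = 0\<close>.\<close>

lemma E_total_eq_geometric_sum:
  assumes indep: "indep_vars (\<lambda>_. count_space UNIV) (\<lambda>(i, j). success i j) ({..<N} \<times> {..<H})"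
    and prob: "\<And>i j. i < N \<Longrightarrow> j < H \<Longrightarrow> prob {\<omega> \<in> space M. success i j \<omega>} = p"
  shows "E_total M N H P_t L_bits R success =
           real N * attempt_energy P_t L_bits R * (\<Sum>j<H. (1 - p) ^ j)"
proof -
  define c where "c = attempt_energy P_t L_bits R"
  \<comment> \<open>For \<open>j < H\<close> this is the event that attempt \<open>j\<close> of
    packet \<open>i\<close> is made. It concerns the \<open>j\<close> earlier outcomes only, hence
    the exponent \<open>j\<close> below.\<close>
  define A where "A i j = {\<omega> \<in> space M. \<forall>k<j. \<not> success i k \<omega>}" for i j
  have A: "A i j \<in> events" "prob (A i j) = (1 - p) ^ j" if "i < N" "j < H" for i j
  proof -
    \<comment> \<open>The first \<open>j\<close> cells in row \<open>i\<close> of the packet-attempt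
      grid; independence passes to this subfamily.\<close>
    let ?S = "Pair i ` {..<j}"
    have indep': "indep_vars (\<lambda>_. count_space UNIV) (\<lambda>(i, j). success i j) ?S"
      using that by (intro indep_vars_subset [OF indep]) auto
    have prob': "prob {\<omega> \<in> space M. (case s of (i, j) \<Rightarrow> success i j) \<omega>} = p" if "s \<in> ?S" for s
      using that \<open>i < N\<close> \<open>j < H\<close> by (auto simp: prob)
    have "A i j = {\<omega> \<in> space M. \<forall>s\<in>?S. \<not> (case s of (i, j) \<Rightarrow> success i j) \<omega>}"
      by (auto simp: A_def)
    moreover have "card ?S = j"
      by (simp add: card_image inj_on_def)
    ultimately show "A i j \<in> events" "prob (A i j) = (1 - p) ^ j"
      using prob_all_fail [OF _ indep' prob'] by simp_all
  qed
  have integrable: "integrable M (\<lambda>\<omega>. c * indicator (A i j) \<omega>)" if "i < N" "j < H" for i j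
    using A(1) [OF that] by (intro integrable_mult_right) (simp add: emeasure_eq_measure)
  have "E_total M N H P_t L_bits R success =
        expectation (\<lambda>\<omega>. \<Sum>i<N. \<Sum>j<H. c * indicator (A i j) \<omega>)"
    unfolding E_total_def
  \<comment> \<open>\<open>A i j\<close> is cut out of \<open>space M\<close>, so the integrands are
    compared on \<open>space M\<close> only.\<close>
  proof (rule Bochner_Integration.integral_cong [OF refl])
    fix \<omega> assume "\<omega> \<in> space M"
    then have "of_bool (\<forall>k<j. \<not> success i k \<omega>) = (indicator (A i j) \<omega> :: real)" for i j
      by (simp add: A_def indicator_def)
    then show "total_energy N H P_t L_bits R success \<omega> = (\<Sum>i<N. \<Sum>j<H. c * indicator (A i j) \<omega>)"
      unfolding total_energy_eq_indicators c_def by (simp only:)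
  qed
  also have "\<dots> = (\<Sum>i<N. expectation (\<lambda>\<omega>. \<Sum>j<H. c * indicator (A i j) \<omega>))"
    using integrable
    by (intro Bochner_Integration.integral_sum Bochner_Integration.integrable_sum)
       (simp only: lessThan_iff)
  also have "\<dots> = (\<Sum>i<N. \<Sum>j<H. expectation (\<lambda>\<omega>. c * indicator (A i j) \<omega>))"
    using integrable
    by (intro sum.cong refl Bochner_Integration.integral_sum) (simp only: lessThan_iff)
  also have "\<dots> = (\<Sum>i<N. \<Sum>j<H. c * (1 - p) ^ j)"
    using A by (intro sum.cong refl) simp
  finally show ?thesis
    by (simp add: c_def sum_distrib_left mult.assoc)
qed

end

theorem lemma2:
  fixes M :: "'w measure"
    and success :: "nat \<Rightarrow> nat \<Rightarrow> 'w \<Rightarrow> bool"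
    and pps T L_bits R P_t PRR :: real
    and N_pkt H :: nat
  assumes "pps > 0" and "T > 0"
    and "real N_pkt = pps * T"
    and "L_bits > 0" and "R > 0" and "P_t > 0"
    and "H \<ge> 1"
    and "0 < PRR" and "PRR \<le> 1"
    and "prob_space M"
    and "prob_space.indep_vars M (\<lambda>_. count_space UNIV) (\<lambda>(i, j). success i j)
           ({..<N_pkt} \<times> {..<H})"
    and "\<And>i j. i < N_pkt \<Longrightarrow> j < H \<Longrightarrow>
           prob_space.prob M {\<omega> \<in> space M. success i j \<omega>} = PRR"
  shows "E_total M N_pkt H P_t L_bits R success =
           real N_pkt * P_t * (L_bits / R) * ((1 - (1 - PRR) ^ H) / PRR)"
proof -
  interpret prob_space M
    by fact
  \<comment> \<open>Positivity of \<open>PRR\<close> keeps the ratio \<open>1 - PRR\<close> away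
    from 1, so the closed form of the geometric sum applies, with denominator
    \<open>1 - (1 - PRR) = PRR\<close>.\<close>
  have "(\<Sum>j<H. (1 - PRR) ^ j) = (1 - (1 - PRR) ^ H) / PRR"
    using \<open>0 < PRR\<close> by (simp add: sum_gp_strict)
  then show ?thesis
    using E_total_eq_geometric_sum [OF assms(11,12)] by (simp add: attempt_energy_def)
qed

end
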